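(* A domain $D\subseteq\{0,1\}^n$ is a local possibility domain if and only if there is a local possibility integrity constraint $\phi$ such that the set of models of $\phi$ equals $D$.
   Context: Standing assumption: domains $D\subseteq\{0,1\}^n$ are non-degenerate, i.e. the projection of $D$ onto each coordinate is $\{0,1\}$. A $k$-ary aggregator for $D$ ($k\ge2$) is an $n$-tuple $(f_1,\ldots,f_n)$ of unanimous functions $f_j:\{0,1\}^k\to\{0,1\}$ such that whenever $x^1,\ldots,x^k\in D$, $(f_1(x^1_1,\ldots,x^k_1),\ldots,f_n(x^1_n,\ldots,x^k_n))\in D$. It is locally non-dictatorial if no $f_j$ equals a projection ${\rm pr}^k_d$. $D$ is a local possibility domain if it admits a locally non-dictatorial aggregator. Horn clause: at most one positive literal. Renaming a set $W$ of variables: swap $x$ and $\neg x$ for all $x\in W$. A formula over $V$ is partially Horn with admissible set $V_0\subseteq V$ (non-empty) if every clause containing only variables from $V_0$ is Horn and the variables of $V_0$ appear only negatively in clauses also containing variables outside $V_0$. For disjoint variable sets $V,V'$, a $(V,V')$-generalized clause is $(l_1\vee\cdots\vee l_s\vee(l_{s+1}\oplus\cdots\oplus l_t))$, $s<t$, with $l_1,\ldots,l_s$ literals of variables in $V$ and $l_{s+1},\ldots,l_t$ literals of variables in $V'$; it is falsified exactly by assignments falsifying all $l_i$, $i\le s$, and satisfying an even number of $l_{s+1},\ldots,l_t$. A formula $\phi$ over $V$ is a local possibility integrity constraint if there are pairwise disjoint $V_0,V_1,V_2\subseteq V$ with union $V$, such that no clause contains variables from both $V_1$ and $V_2$, and: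 (1) renaming some variables of $V_0$ yields a partially Horn formula with admissible set $V_0$; (2) every clause contains at most two variables from $V_1$; (3) the clauses containing variables from $V_2$ are $(V_0,V_2)$-generalized clauses.
   Formalization: In the definition of local possibility integrity constraint, V_0 may be empty, and condition (1) is then void; if V_0 had to be non-empty, as for admissible sets, the claim would fail for the domain {000,110,101,011}. *)

theory Defs
  imports Main
begin

section \<open>Domains and aggregators\<close>

text \<open>A point of \<open>{0,1}\<^sup>n\<close> is a function \<open>'n \<Rightarrow> bool\<close>, where the finite type
  \<open>'n\<close> has \<open>n\<close> elements. Since the arity \<open>k\<close> of an aggregator is quantified,
  a function \<open>{0,1}\<^sup>k \<rightarrow> {0,1}\<close> is a function on Boolean lists, only its values on lists of
  length \<open>k\<close> being relevant.\<close>

definition nondegenerate :: "('n \<Rightarrow> bool) set \<Rightarrow> bool" where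
  "nondegenerate D \<longleftrightarrow> (\<forall>j. (\<lambda>x. x j) ` D = {False, True})"

definition unanimous :: "nat \<Rightarrow> (bool list \<Rightarrow> bool) \<Rightarrow> bool" where
  "unanimous k g \<longleftrightarrow> (\<forall>a. g (replicate k a) = a)"

definition is_projection :: "nat \<Rightarrow> (bool list \<Rightarrow> bool) \<Rightarrow> bool" where
  "is_projection k g \<longleftrightarrow> (\<exists>d<k. \<forall>v. length v = k \<longrightarrow> g v = v ! d)"

definition aggregator ::
  "nat \<Rightarrow> ('n \<Rightarrow> bool) set \<Rightarrow> ('n \<Rightarrow> bool list \<Rightarrow> bool) \<Rightarrow> bool" where
  "aggregator k D f \<longleftrightarrow>
     2 \<le> k \<and>
     (\<forall>j. unanimous k (f j)) \<and>
     (\<forall>xs. length xs = k \<and> set xs \<subseteq> D \<longrightarrow> (\<lambda>j. f j (map (\<lambda>x. x j) xs)) \<in> D)"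

definition locally_nondictatorial :: "nat \<Rightarrow> ('n \<Rightarrow> bool list \<Rightarrow> bool) \<Rightarrow> bool" where
  "locally_nondictatorial k f \<longleftrightarrow> (\<forall>j. \<not> is_projection k (f j))"

definition local_possibility_domain :: "('n \<Rightarrow> bool) set \<Rightarrow> bool" where
  "local_possibility_domain D \<longleftrightarrow>
     (\<exists>k f. aggregator k D f \<and> locally_nondictatorial k f)"


section \<open>Formulas\<close>

datatype 'v literal = Pos 'v | Neg 'v

text \<open>\<open>Clause [l\<^sub>1, \<dots>, l\<^sub>s] [l\<^sub>s\<^sub>+\<^sub>1, \<dots>, l\<^sub>t]\<close> stands for
  \<open>l\<^sub>1 \<or> \<dots> \<or> l\<^sub>s \<or> (l\<^sub>s\<^sub>+\<^sub>1 \<oplus> \<dots> \<oplus> l\<^sub>t)\<close>. Ordinary clauses are those with an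
  empty second list (the empty sum is false). The case \<open>t = s + 1\<close> of a generalized clause, which
  is also a plain disjunction, is written with a one-element second list. A formula is the
  conjunction of its clauses.\<close>

datatype 'v clause = Clause (disj_part: "'v literal list") (xor_part: "'v literal list")

type_synonym 'v formula = "'v clause list"

fun lit_var :: "'v literal \<Rightarrow> 'v" where
  "lit_var (Pos v) = v"
| "lit_var (Neg v) = v"

fun is_pos :: "'v literal \<Rightarrow> bool" where
  "is_pos (Pos v) = True"
| "is_pos (Neg v) = False"

fun lit_true :: "('v \<Rightarrow> bool) \<Rightarrow> 'v literal \<Rightarrow> bool" where
  "lit_true x (Pos v) = x v"
| "lit_true x (Neg v) = (\<not> x v)"

definition clause_lits :: "'v clause \<Rightarrow> 'v literal set" where
  "clause_lits C = set (disj_part C) \<union> set (xor_part C)"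

definition clause_vars :: "'v clause \<Rightarrow> 'v set" where
  "clause_vars C = lit_var ` clause_lits C"

definition formula_over :: "'v set \<Rightarrow> 'v formula \<Rightarrow> bool" where
  "formula_over V \<phi> \<longleftrightarrow> (\<forall>C\<in>set \<phi>. clause_vars C \<subseteq> V)"

definition clause_true :: "('v \<Rightarrow> bool) \<Rightarrow> 'v clause \<Rightarrow> bool" where
  "clause_true x C \<longleftrightarrow>
     (\<exists>l\<in>set (disj_part C). lit_true x l) \<or>
     odd (length (filter (lit_true x) (xor_part C)))"

definition models :: "'v formula \<Rightarrow> ('v \<Rightarrow> bool) set" where
  "models \<phi> = {x. \<forall>C\<in>set \<phi>. clause_true x C}"

fun rename_lit :: "'v set \<Rightarrow> 'v literal \<Rightarrow> 'v literal" where
  "rename_lit W (Pos v) = (if v \<in> W then Neg v else Pos v)"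
| "rename_lit W (Neg v) = (if v \<in> W then Pos v else Neg v)"

definition rename_clause :: "'v set \<Rightarrow> 'v clause \<Rightarrow> 'v clause" where
  "rename_clause W C =
     Clause (map (rename_lit W) (disj_part C)) (map (rename_lit W) (xor_part C))"

definition rename :: "'v set \<Rightarrow> 'v formula \<Rightarrow> 'v formula" where
  "rename W \<phi> = map (rename_clause W) \<phi>"

definition horn_clause :: "'v clause \<Rightarrow> bool" where
  "horn_clause C \<longleftrightarrow> xor_part C = [] \<and> length (filter is_pos (disj_part C)) \<le> 1"

definition partially_horn :: "'v set \<Rightarrow> 'v set \<Rightarrow> 'v formula \<Rightarrow> bool" where
  "partially_horn V V0 \<phi> \<longleftrightarrow>
     formula_over V \<phi> \<and> V0 \<subseteq> V \<and> V0 \<noteq> {} \<and>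
     (\<forall>C\<in>set \<phi>. clause_vars C \<subseteq> V0 \<longrightarrow> horn_clause C) \<and>
     (\<forall>C\<in>set \<phi>. \<not> clause_vars C \<subseteq> V0 \<longrightarrow>
        (\<forall>l\<in>clause_lits C. lit_var l \<in> V0 \<longrightarrow> \<not> is_pos l))"

text \<open>\<open>s = 0\<close> is allowed, giving the affine clauses.\<close>

definition generalized_clause :: "'v set \<Rightarrow> 'v set \<Rightarrow> 'v clause \<Rightarrow> bool" where
  "generalized_clause V V' C \<longleftrightarrow>
     lit_var ` set (disj_part C) \<subseteq> V \<and> lit_var ` set (xor_part C) \<subseteq> V' \<and> xor_part C \<noteq> []"

text \<open>Any of \<open>V0\<close>, \<open>V1\<close>, \<open>V2\<close> may be empty, so that bijunctive and affine formulas are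
  included; as an admissible set is by definition non-empty, the partially Horn condition is void
  for \<open>V0 = {}\<close>. Sums occur only in the \<open>(V0, V2)\<close>-generalized clauses: the clauses
  without variables from \<open>V2\<close> are ordinary.\<close>

definition local_possibility_integrity_constraint :: "'v set \<Rightarrow> 'v formula \<Rightarrow> bool" where
  "local_possibility_integrity_constraint V \<phi> \<longleftrightarrow>
     formula_over V \<phi> \<and>
     (\<exists>V0 V1 V2.
        V0 \<inter> V1 = {} \<and> V0 \<inter> V2 = {} \<and> V1 \<inter> V2 = {} \<and> V0 \<union> V1 \<union> V2 = V \<and>
        (\<forall>C\<in>set \<phi>. clause_vars C \<inter> V1 = {} \<or> clause_vars C \<inter> V2 = {}) \<and>
        (V0 \<noteq> {} \<longrightarrow> (\<exists>W\<subseteq>V0. partially_horn V V0 (rename W \<phi>))) \<and>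
        (\<forall>C\<in>set \<phi>. card (clause_vars C \<inter> V1) \<le> 2) \<and>
        (\<forall>C\<in>set \<phi>. clause_vars C \<inter> V2 \<noteq> {} \<longrightarrow> generalized_clause V0 V2 C) \<and>
        (\<forall>C\<in>set \<phi>. clause_vars C \<inter> V2 = {} \<longrightarrow> xor_part C = []))"

end

theory Submission
  imports Defs
begin

text \<open>A cyclically symmetric unanimous ternary Boolean function depends only on the number of
  true arguments, so it is one of \<open>\<and>\<close>, \<open>\<or>\<close>, \<open>maj\<close>, \<open>\<oplus>\<close>. From a locally non-dictatorial
  aggregator one obtains, for each issue separately, a ternary aggregator that is cyclic on that
  issue; the composition \<open>s (g x y z) (g y z x) (g z x y)\<close> is cyclic wherever \<open>s\<close> or \<open>g\<close> is, so
  some ternary aggregator \<open>g\<close> is cyclic on all issues. Then \<open>V0\<close> collects the issues with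
  \<open>\<and>\<close> or \<open>\<or>\<close> (the latter are renamed), \<open>V1\<close> those with \<open>maj\<close> and \<open>V2\<close> those with
  \<open>\<oplus>\<close>. For \<open>y \<notin> D\<close> let \<open>U\<close> be the set of issues of \<open>V0\<close> that are true in the renamed \<open>y\<close>. If
  every admissible clause valid in \<open>D\<close> held at \<open>y\<close>, then closure under \<open>\<and>\<close>, the
  Baker--Pixley argument and linear algebra over the field with two elements would give points of \<open>D\<close>
  that agree with \<open>y\<close> on \<open>U\<close> and on \<open>V0\<close>, \<open>V1\<close>, \<open>V2\<close>, respectively, and \<open>g\<close> glues these
  together to \<open>y\<close>. Conversely, the models of a constraint are closed under the corresponding
  ternary functions.\<close>

section \<open>Ternary aggregators\<close>

definition ternary_aggregator ::
  "('n \<Rightarrow> bool) set \<Rightarrow> ('n \<Rightarrow> bool \<Rightarrow> bool \<Rightarrow> bool \<Rightarrow> bool) \<Rightarrow> bool" where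
  "ternary_aggregator D g \<longleftrightarrow>
     (\<forall>j a. g j a a a = a) \<and>
     (\<forall>x\<in>D. \<forall>y\<in>D. \<forall>z\<in>D. (\<lambda>j. g j (x j) (y j) (z j)) \<in> D)"

definition cyclic :: "(bool \<Rightarrow> bool \<Rightarrow> bool \<Rightarrow> bool) \<Rightarrow> bool" where
  "cyclic t \<longleftrightarrow> (\<forall>a b c. t a b c = t b c a)"

lemma ternary_aggregator_comp:
  assumes "ternary_aggregator D s" "ternary_aggregator D g1" "ternary_aggregator D g2"
    "ternary_aggregator D g3"
  shows "ternary_aggregator D (\<lambda>j a b c. s j (g1 j a b c) (g2 j a b c) (g3 j a b c))"
  using assms unfolding ternary_aggregator_def by simp

lemma ternary_aggregator_proj:
  "ternary_aggregator D (\<lambda>j a b c. a)"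
  "ternary_aggregator D (\<lambda>j a b c. b)"
  "ternary_aggregator D (\<lambda>j a b c. c)"
  by (simp_all add: ternary_aggregator_def)

lemma ternary_aggregator_rotate:
  assumes "ternary_aggregator D g"
  shows "ternary_aggregator D (\<lambda>j a b c. g j b c a)"
  using assms unfolding ternary_aggregator_def by simp

lemma ternary_aggregator_minor:
  assumes "aggregator k D f"
  shows "ternary_aggregator D
    (\<lambda>j a b c. f j (map (\<lambda>i. if i \<in> A then a else if i \<in> B then b else c) [0..<k]))"
  unfolding ternary_aggregator_def
proof (intro conjI allI ballI)
  fix j a
  show "f j (map (\<lambda>i. if i \<in> A then a else if i \<in> B then a else a) [0..<k]) = a"
    using assms by (simp add: aggregator_def unanimous_def map_replicate_const)
next
  fix x y z assume "x \<in> D" "y \<in> D" "z \<in> D"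
  let ?xs = "map (\<lambda>i. if i \<in> A then x else if i \<in> B then y else z) [0..<k]"
  have "length ?xs = k" "set ?xs \<subseteq> D"
    using \<open>x \<in> D\<close> \<open>y \<in> D\<close> \<open>z \<in> D\<close> by auto
  then have "(\<lambda>j. f j (map (\<lambda>x. x j) ?xs)) \<in> D"
    using assms unfolding aggregator_def by blast
  moreover have "(\<lambda>j. f j (map (\<lambda>x. x j) ?xs)) =
      (\<lambda>j. f j (map (\<lambda>i. if i \<in> A then x j else if i \<in> B then y j else z j) [0..<k]))"
    by (intro ext arg_cong[where f = "f _"]) auto
  ultimately show "(\<lambda>j. f j (map (\<lambda>i. if i \<in> A then x j else if i \<in> B then y j else z j)
      [0..<k])) \<in> D"
    by (rule back_subst)
qed

text \<open>By self-duality \<open>t\<close> is determined by its values at the three inputs with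
  one true argument. Of the eight possibilities three are projections, and majority and parity are
  cyclic. The other three are majority with one argument negated; putting the value of
  \<open>t\<close> in place of that argument yields majority.\<close>

lemma cyclic_of_self_dual:
  assumes idem: "\<And>a. t a a a = a"
    and dual: "\<And>a b c. t (\<not> a) (\<not> b) (\<not> c) = (\<not> t a b c)"
    and "\<not> (\<forall>a b c. t a b c = a)" "\<not> (\<forall>a b c. t a b c = b)" "\<not> (\<forall>a b c. t a b c = c)"
  shows "cyclic t \<or> cyclic (\<lambda>a b c. t (t a b c) b c) \<or> cyclic (\<lambda>a b c. t a (t a b c) c) \<or>
    cyclic (\<lambda>a b c. t a b (t a b c))"
proof -
  have "t True True False = (\<not> t False False True)" "t True False True = (\<not> t False True False)"
    "t False True True = (\<not> t True False False)"
    using dual[of False False True] dual[of False True False] dual[of True False False] by auto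
  then show ?thesis
    using assms(3-5) idem[of True] idem[of False] unfolding cyclic_def all_bool_eq
    by (cases "t True False False"; cases "t False True False"; cases "t False False True") simp_all
qed

text \<open>If both alternatives failed, the family of all \<open>A\<close> with \<open>S A\<close> would be an ultrafilter on
  the finite set \<open>{..<k}\<close>, hence principal, and \<open>F\<close> would be a projection.\<close>

lemma nonprojection_minor:
  assumes un: "unanimous k F" and np: "\<not> is_projection k F"
  defines "S \<equiv> \<lambda>A. F (map (\<lambda>i. i \<in> A) [0..<k])"
  shows "(\<exists>A. S A = S (- A)) \<or>
    (\<exists>A B. A \<inter> B = {} \<and> \<not> (S (A \<union> B) \<longleftrightarrow> S A \<or> S B))"
proof (rule ccontr)
  assume neg: "\<not> ?thesis"
  then have dual: "S (- A) = (\<not> S A)" for A by blast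
  from neg have un2: "S (A \<union> B) \<longleftrightarrow> S A \<or> S B" if "A \<inter> B = {}" for A B
    using that by blast
  have empty: "\<not> S {}"
    using un by (simp add: S_def unanimous_def map_replicate_const)
  have sing: "\<exists>d\<in>A. S {d}" if "finite A" "S A" for A
    using that
  proof (induction A rule: finite_induct)
    case empty
    then show ?case using \<open>\<not> S {}\<close> by simp
  next
    case (insert a A)
    then show ?case using un2[of "{a}" A] by auto
  qed
  have "S {..<k} = S UNIV"
    unfolding S_def by (rule arg_cong[where f = F]) simp
  then have "S {..<k}" using dual[of "{}"] empty by simp
  then obtain d where d: "d < k" "S {d}" using sing[of "{..<k}"] by auto
  have mem: "S B" if "d \<in> B" for B
    using un2[of "{d}" "B - {d}"] d that by (auto simp: insert_absorb)
  have "F v = v ! d" if "length v = k" for v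
  proof -
    have "map (\<lambda>i. i \<in> {i. v ! i}) [0..<k] = v"
      using that by (auto intro: nth_equalityI)
    then have "F v = S {i. v ! i}" by (simp add: S_def)
    also have "\<dots> = v ! d"
      using mem[of "{i. v ! i}"] mem[of "- {i. v ! i}"] dual[of "{i. v ! i}"] by auto
    finally show ?thesis .
  qed
  then show False using np d unfolding is_projection_def by blast
qed

text \<open>Either outcome of \<open>nonprojection_minor\<close> yields a minor to work with:
  \<open>S A = S (- A)\<close> gives a commutative binary operation; otherwise \<open>f j\<close> is
  self-dual, and a failure of additivity gives a self-dual ternary minor that is no
  projection.\<close>

lemma cyclic_at_issue:
  assumes agg: "aggregator k D f" and np: "\<not> is_projection k (f j)"
  shows "\<exists>g. ternary_aggregator D g \<and> cyclic (g j)"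
proof -
  define S where "S = (\<lambda>A. f j (map (\<lambda>i. i \<in> A) [0..<k]))"
  define m where "m A B = (\<lambda>j a b c.
    f j (map (\<lambda>i. if i \<in> A then a else if i \<in> B then b else c) [0..<k]))" for A B
  have m: "ternary_aggregator D (m A B)" for A B
    unfolding m_def by (rule ternary_aggregator_minor[OF agg])
  have mS: "m A B j a b c = S ({i\<in>A. a} \<union> {i\<in>B - A. b} \<union> {i\<in>- (A \<union> B). c})" for A B a b c
    unfolding m_def S_def by (intro arg_cong[where f = "f j"] map_cong refl) auto
  have idem: "m A B j a a a = a" for A B a
    using m unfolding ternary_aggregator_def by blast
  have un: "unanimous k (f j)" using agg by (simp add: aggregator_def)
  show ?thesis
  proof (cases "\<exists>A. S A = S (- A)")
    case True
    then obtain A where A: "S A = S (- A)" by blast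
    let ?b = "\<lambda>j a b. m A {} j a b b"
    have b: "?b j False True = ?b j True False"
      using A by (simp add: mS Compl_eq)
    \<comment> \<open>At \<open>j\<close> an idempotent commutative binary operation is conjunction
      or disjunction, so its iteration is cyclic.\<close>
    let ?g = "\<lambda>j a b c. ?b j (?b j a b) c"
    have "ternary_aggregator D (\<lambda>j a b c. ?b j a b)"
      by (rule ternary_aggregator_comp[OF m ternary_aggregator_proj(1,2,2)])
    from ternary_aggregator_comp[OF this this ternary_aggregator_proj(3,3)]
    have "ternary_aggregator D ?g" .
    moreover have "cyclic (?g j)"
      using b idem[of A "{}" True] idem[of A "{}" False] unfolding cyclic_def all_bool_eq
      by (cases "?b j True False") simp_all
    ultimately show ?thesis by blast
  next
    case False
    then have dual: "S (- A) = (\<not> S A)" for A by blast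
    obtain A B where AB: "A \<inter> B = {}" "\<not> (S (A \<union> B) \<longleftrightarrow> S A \<or> S B)"
      using nonprojection_minor[OF un np] False unfolding S_def by blast
    let ?t = "m A B j"
    have d: "?t (\<not> a) (\<not> b) (\<not> c) = (\<not> ?t a b c)" for a b c
    proof -
      have "{i\<in>A. \<not> a} \<union> {i\<in>B - A. \<not> b} \<union> {i\<in>- (A \<union> B). \<not> c} =
          - ({i\<in>A. a} \<union> {i\<in>B - A. b} \<union> {i\<in>- (A \<union> B). c})"
        by auto
      then show ?thesis unfolding mS dual[symmetric] by simp
    qed
    have BA: "B - A = B" using AB(1) by auto
    have val: "?t True True False = S (A \<union> B)" "?t True False False = S A"
      "?t False True False = S B"
      by (simp_all add: mS BA)
    have "cyclic ?t \<or> cyclic (\<lambda>a b c. ?t (?t a b c) b c) \<or> cyclic (\<lambda>a b c. ?t a (?t a b c) c) \<or>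
        cyclic (\<lambda>a b c. ?t a b (?t a b c))"
    proof (rule cyclic_of_self_dual[where t = "?t", OF idem d])
      \<comment> \<open>The value of a projection at \<open>True True False\<close> is the
        disjunction of its values at \<open>True False False\<close> and
        \<open>False True False\<close>; the choice of \<open>A\<close> and \<open>B\<close>
        violates this.\<close>
      show "\<not> (\<forall>a b c. ?t a b c = a)" "\<not> (\<forall>a b c. ?t a b c = b)" "\<not> (\<forall>a b c. ?t a b c = c)"
        using AB(2) val[symmetric] by (intro notI; simp)+
    qed
    moreover have
      "ternary_aggregator D (\<lambda>j a b c. m A B j (m A B j a b c) b c)"
      "ternary_aggregator D (\<lambda>j a b c. m A B j a (m A B j a b c) c)"
      "ternary_aggregator D (\<lambda>j a b c. m A B j a b (m A B j a b c))"
      by (rule ternary_aggregator_comp[OF m m ternary_aggregator_proj(2,3)]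
          ternary_aggregator_comp[OF m ternary_aggregator_proj(1) m ternary_aggregator_proj(3)]
          ternary_aggregator_comp[OF m ternary_aggregator_proj(1,2) m])+
    ultimately show ?thesis using m[of A B] by blast
  qed
qed

lemma cyclic_ternary_aggregator:
  fixes D :: "('n::finite \<Rightarrow> bool) set"
  assumes "local_possibility_domain D"
  obtains g where "ternary_aggregator D g" "\<And>j. cyclic (g j)"
proof -
  obtain k f where "aggregator k D f" "\<And>j. \<not> is_projection k (f j)"
    using assms unfolding local_possibility_domain_def locally_nondictatorial_def by blast
  then have ex: "\<exists>g. ternary_aggregator D g \<and> cyclic (g j)" for j
    by (rule cyclic_at_issue)
  have "\<exists>g. ternary_aggregator D g \<and> (\<forall>j\<in>I. cyclic (g j))" if "finite I" for I
    using that
  proof (induction I rule: finite_induct)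
    case empty
    then show ?case using ternary_aggregator_proj(1) by blast
  next
    case (insert i I)
    then obtain g where g: "ternary_aggregator D g" "\<And>j. j \<in> I \<Longrightarrow> cyclic (g j)" by blast
    obtain s where s: "ternary_aggregator D s" "cyclic (s i)" using ex by blast
    \<comment> \<open>At \<open>i\<close>, rotating the arguments rotates the three inner values,
      which \<open>s i\<close> does not notice. On \<open>I\<close> the inner values coincide, and
      unanimity of \<open>s\<close> leaves \<open>g\<close> unchanged.\<close>
    let ?h = "\<lambda>j a b c. s j (g j a b c) (g j b c a) (g j c a b)"
    have "ternary_aggregator D ?h"
      by (rule ternary_aggregator_comp[OF s(1) g(1) ternary_aggregator_rotate[OF g(1)]
            ternary_aggregator_rotate[OF ternary_aggregator_rotate[OF g(1)]]])
    moreover have "cyclic (?h i)"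
      using s(2) unfolding cyclic_def by blast
    moreover have "cyclic (?h j)" if "j \<in> I" for j
    proof -
      have "?h j = g j"
      proof (intro ext)
        fix a b c
        have "g j a b c = g j b c a" "g j b c a = g j c a b"
          using g(2)[OF that] unfolding cyclic_def by blast+
        then show "?h j a b c = g j a b c"
          using s(1) unfolding ternary_aggregator_def by simp
      qed
      then show ?thesis using g(2)[OF that] by simp
    qed
    ultimately show ?case by blast
  qed
  from this[of UNIV] obtain g where "ternary_aggregator D g" "\<forall>j\<in>UNIV. cyclic (g j)" by auto
  then show thesis by (intro that[of g]) auto
qed

text \<open>A projection is true at exactly one of the three inputs with a single true argument,
  whereas a cyclic operation has equal values there.\<close>

lemma local_possibility_domain_of_cyclic:
  assumes g: "ternary_aggregator D g" and cyc: "\<And>j. cyclic (g j)"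
  shows "local_possibility_domain D"
proof -
  let ?f = "\<lambda>j v. g j (v ! 0) (v ! 1) (v ! 2)"
  have "aggregator 3 D ?f"
    unfolding aggregator_def
  proof (intro conjI allI impI)
    fix j show "unanimous 3 (?f j)"
      using g by (simp add: unanimous_def ternary_aggregator_def)
  next
    fix xs assume xs: "length xs = 3 \<and> set xs \<subseteq> D"
    then have "xs ! 0 \<in> D" "xs ! 1 \<in> D" "xs ! 2 \<in> D" by (auto simp: subset_iff)
    then show "(\<lambda>j. ?f j (map (\<lambda>x. x j) xs)) \<in> D"
      using g xs by (simp add: ternary_aggregator_def)
  qed simp
  moreover have "\<not> is_projection 3 (?f j)" for j
  proof
    assume "is_projection 3 (?f j)"
    then obtain d where d: "d < 3" "\<And>v. length v = 3 \<Longrightarrow> ?f j v = v ! d"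
      unfolding is_projection_def by blast
    have "g j True False False = g j False False True" "g j False False True = g j False True False"
      using cyc[of j] unfolding cyclic_def by blast+
    moreover have "d = 0 \<or> d = 1 \<or> d = 2" using d(1) by linarith
    ultimately show False
      using d(2)[of "[True, False, False]"] d(2)[of "[False, True, False]"]
        d(2)[of "[False, False, True]"]
      by auto
  qed
  ultimately show ?thesis
    unfolding local_possibility_domain_def locally_nondictatorial_def by blast
qed


section \<open>Models of a constraint\<close>

lemma lit_true_rename: "lit_true (\<lambda>v. x v = (v \<notin> W)) (rename_lit W l) = lit_true x l"
  by (cases l) auto

lemma lit_var_rename [simp]: "lit_var (rename_lit W l) = lit_var l"
  by (cases l) auto

lemma disj_part_rename [simp]: "disj_part (rename_clause W C) = map (rename_lit W) (disj_part C)"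
  and xor_part_rename [simp]: "xor_part (rename_clause W C) = map (rename_lit W) (xor_part C)"
  by (simp_all add: rename_clause_def)

lemma clause_lits_rename [simp]: "clause_lits (rename_clause W C) = rename_lit W ` clause_lits C"
  by (auto simp: clause_lits_def)

lemma clause_vars_rename [simp]: "clause_vars (rename_clause W C) = clause_vars C"
  by (simp add: clause_vars_def image_image)

text \<open>Parity is linear over the field with two elements. This serves the sums in generalized
  clauses and, through \<open>odd_card_sym_diff3\<close>, linear forms given by their
  supports.\<close>

lemma odd_length_filter_xor:
  assumes "\<And>l. l \<in> set ls \<Longrightarrow> P l = (P1 l \<noteq> (P2 l \<noteq> P3 l))"
  shows "odd (length (filter P ls)) =
    (odd (length (filter P1 ls)) \<noteq> (odd (length (filter P2 ls)) \<noteq> odd (length (filter P3 ls))))"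
  using assms by (induction ls) auto

text \<open>If \<open>y\<close> falsified the clause, every \<open>x i\<close> would satisfy it by a
  positive literal, since a negative literal true at some \<open>x i\<close> is true at the
  conjunction. The Horn property leaves just one such literal, so it holds at all \<open>x i\<close>
  and hence at \<open>y\<close>.\<close>

lemma horn_clause_conj:
  assumes horn: "horn_clause C"
    and true: "\<And>i. i \<in> I \<Longrightarrow> clause_true (x i) C" and "I \<noteq> {}"
    and conj: "\<And>v. v \<in> clause_vars C \<Longrightarrow> y v \<longleftrightarrow> (\<forall>i\<in>I. x i v)"
  shows "clause_true y C"
proof (rule ccontr)
  assume "\<not> clause_true y C"
  then have false: "\<not> lit_true y l" if "l \<in> set (disj_part C)" for l
    using that by (auto simp: clause_true_def)
  have var: "lit_var l \<in> clause_vars C" if "l \<in> set (disj_part C)" for l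
    using that by (auto simp: clause_vars_def clause_lits_def)
  have pos: "\<exists>l\<in>set (filter is_pos (disj_part C)). lit_true (x i) l" if iI: "i \<in> I" for i
  proof -
    obtain l where l: "l \<in> set (disj_part C)" "lit_true (x i) l"
      using true[OF iI] horn by (auto simp: clause_true_def horn_clause_def)
    moreover have "is_pos l"
      using false[OF l(1)] conj[OF var[OF l(1)]] l(2) iI by (cases l) auto
    ultimately show ?thesis by auto
  qed
  obtain i where "i \<in> I" using \<open>I \<noteq> {}\<close> by blast
  then obtain l where l: "filter is_pos (disj_part C) = [l]"
    using pos horn
    by (cases "filter is_pos (disj_part C)") (auto simp: horn_clause_def)
  then have "l \<in> set (filter is_pos (disj_part C))" by simp
  then have lC: "l \<in> set (disj_part C)" "is_pos l" by simp_all
  have "\<forall>i\<in>I. lit_true (x i) l" using pos l by auto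
  then have "lit_true y l"
    using conj[OF var[OF lC(1)]] lC(2) by (cases l) auto
  then show False using false lC(1) by blast
qed

lemma constraint_models_cyclic:
  assumes "local_possibility_integrity_constraint UNIV \<phi>"
  obtains g where "ternary_aggregator (models \<phi>) g" "\<And>j. cyclic (g j)"
proof -
  obtain V0 V1 V2 where
    disj: "V0 \<inter> V1 = {}" "V0 \<inter> V2 = {}" "V1 \<inter> V2 = {}" "V0 \<union> V1 \<union> V2 = UNIV"
    and sep: "\<forall>C\<in>set \<phi>. clause_vars C \<inter> V1 = {} \<or> clause_vars C \<inter> V2 = {}"
    and ph: "V0 \<noteq> {} \<longrightarrow> (\<exists>W\<subseteq>V0. partially_horn UNIV V0 (rename W \<phi>))"
    and two: "\<forall>C\<in>set \<phi>. card (clause_vars C \<inter> V1) \<le> 2"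
    and gen: "\<forall>C\<in>set \<phi>. clause_vars C \<inter> V2 \<noteq> {} \<longrightarrow> generalized_clause V0 V2 C"
    and ord: "\<forall>C\<in>set \<phi>. clause_vars C \<inter> V2 = {} \<longrightarrow> xor_part C = []"
    using assms unfolding local_possibility_integrity_constraint_def
    by (elim conjE exE) (rule that)
  obtain W where W: "V0 \<noteq> {} \<Longrightarrow> partially_horn UNIV V0 (rename W \<phi>)"
    using ph by blast
  define g where "g j a b c =
    (if j \<in> V0 then (if j \<in> W then a \<or> b \<or> c else a \<and> b \<and> c)
     else if j \<in> V1 then (a \<and> b) \<or> (b \<and> c) \<or> (a \<and> c)
     else a \<noteq> (b \<noteq> c))" for j a b c
  have cyc: "cyclic (g j)" for j
    unfolding cyclic_def g_def by auto
  \<comment> \<open>\<open>W\<close> is constrained only when \<open>V0\<close> is non-empty, which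
    a variable of the clause ensures. Clauses without variables are treated apart.\<close>
  have horn: "horn_clause (rename_clause W C)"
    if "C \<in> set \<phi>" "clause_vars C \<subseteq> V0" "clause_vars C \<noteq> {}" for C
    using that W by (auto simp: partially_horn_def rename_def)
  have negative: "\<not> is_pos (rename_lit W l)"
    if "C \<in> set \<phi>" "\<not> clause_vars C \<subseteq> V0" "l \<in> clause_lits C" "lit_var l \<in> V0" for C l
    using that W by (fastforce simp: partially_horn_def rename_def)
  have "(\<lambda>j. g j (x1 j) (x2 j) (x3 j)) \<in> models \<phi>"
    if x: "x1 \<in> models \<phi>" "x2 \<in> models \<phi>" "x3 \<in> models \<phi>" for x1 x2 x3
    unfolding models_def
  proof (intro CollectI ballI)
    let ?y = "\<lambda>j. g j (x1 j) (x2 j) (x3 j)"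
    fix C assume C: "C \<in> set \<phi>"
    have tr: "clause_true x1 C" "clause_true x2 C" "clause_true x3 C"
      using x C by (auto simp: models_def)
    have var: "lit_var l \<in> clause_vars C" if "l \<in> set (disj_part C)" for l
      using that by (auto simp: clause_vars_def clause_lits_def)
    show "clause_true ?y C"
    proof (cases "clause_vars C \<subseteq> V0")
      case True
      show ?thesis
      proof (cases "clause_vars C = {}")
        case True
        then show ?thesis using tr
          by (auto simp: clause_true_def clause_vars_def clause_lits_def)
      next
        case False
        \<comment> \<open>The point in renamed coordinates, where \<open>g\<close> is conjunction on
          all of \<open>V0\<close>.\<close>
        let ?tw = "\<lambda>x v. x v \<noteq> (v \<in> W)"
        have tw: "clause_true (?tw x) (rename_clause W C) = clause_true x C" for x
          by (simp add: clause_true_def filter_map o_def lit_true_rename)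
        have "clause_true (?tw ?y) (rename_clause W C)"
        proof (rule horn_clause_conj[where I = "{x1, x2, x3}" and x = ?tw])
          show "horn_clause (rename_clause W C)" using horn C True False by blast
        next
          fix x assume "x \<in> {x1, x2, x3}"
          then show "clause_true (?tw x) (rename_clause W C)" using tr tw by auto
        next
          fix v assume "v \<in> clause_vars (rename_clause W C)"
          then have "v \<in> V0" using True by auto
          then show "?tw ?y v \<longleftrightarrow> (\<forall>x\<in>{x1, x2, x3}. ?tw x v)"
            by (auto simp: g_def)
        qed simp
        then show ?thesis using tw by blast
      qed
    next
      case notV0: False
      show ?thesis
      proof (rule ccontr)
        assume nt: "\<not> clause_true ?y C"
        have false: "\<not> lit_true ?y l" if "l \<in> set (disj_part C)" for l
          using that nt by (auto simp: clause_true_def)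
        \<comment> \<open>Such a literal is negative after renaming, so its falsity at the
          conjunction means that its variable is true, in renamed coordinates, at all three
          points.\<close>
        have false0: "\<not> lit_true x1 l \<and> \<not> lit_true x2 l \<and> \<not> lit_true x3 l"
          if "l \<in> set (disj_part C)" "lit_var l \<in> V0" for l
        proof -
          have "\<not> is_pos (rename_lit W l)"
            using negative C notV0 that by (auto simp: clause_lits_def)
          then show ?thesis
            using false[OF that(1)] that(2) by (cases l) (auto simp: g_def split: if_splits)
        qed
        show False
        proof (cases "clause_vars C \<inter> V2 = {}")
          case True
          then have xor: "xor_part C = []" using ord C by blast
          have ex: "\<exists>l\<in>set (disj_part C). lit_true x l \<and> lit_var l \<in> clause_vars C \<inter> V1"
            if xin: "x \<in> {x1, x2, x3}" for x
          proof -
            obtain l where l: "l \<in> set (disj_part C)" "lit_true x l"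
              using tr xin xor by (auto simp: clause_true_def)
            then have "lit_var l \<notin> V0" "lit_var l \<notin> V2"
              using false0 xin var True by auto
            then show ?thesis using l var disj(4) by blast
          qed
          obtain l1 where l1: "l1 \<in> set (disj_part C)" "lit_true x1 l1"
            "lit_var l1 \<in> clause_vars C \<inter> V1" using ex by blast
          obtain l2 where l2: "l2 \<in> set (disj_part C)" "lit_true x2 l2"
            "lit_var l2 \<in> clause_vars C \<inter> V1" using ex by blast
          obtain l3 where l3: "l3 \<in> set (disj_part C)" "lit_true x3 l3"
            "lit_var l3 \<in> clause_vars C \<inter> V1" using ex by blast
          have fin: "finite (clause_vars C \<inter> V1)"
            by (simp add: clause_vars_def clause_lits_def)
          \<comment> \<open>Pigeonhole: the three true literals use at most two variables, so two of
            them share one. If these two are equal, majority makes them true; if they are opposite,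
            one of them is true anyway.\<close>
          have "card {lit_var l1, lit_var l2, lit_var l3} \<le> card (clause_vars C \<inter> V1)"
            by (rule card_mono[OF fin]) (use l1 l2 l3 in auto)
          also have "\<dots> \<le> 2" using two C by blast
          finally have eq: "lit_var l1 = lit_var l2 \<or> lit_var l1 = lit_var l3 \<or>
              lit_var l2 = lit_var l3"
            by (auto simp: card_insert_if split: if_splits)
          have maj: "g v a b c = ((a \<and> b) \<or> (b \<and> c) \<or> (a \<and> c))" if "v \<in> V1" for v a b c
            using that disj by (auto simp: g_def)
          have y: "?y (lit_var l) = ((x1 (lit_var l) \<and> x2 (lit_var l)) \<or>
              (x2 (lit_var l) \<and> x3 (lit_var l)) \<or> (x1 (lit_var l) \<and> x3 (lit_var l)))"
            if "l \<in> {l1, l2, l3}" for l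
            using that l1(3) l2(3) l3(3) by (intro maj) auto
          from eq show False
          proof (elim disjE)
            assume "lit_var l1 = lit_var l2"
            then show False
              using false[OF l1(1)] false[OF l2(1)] l1(2) l2(2) y[of l1]
              by (cases l1; cases l2) auto
          next
            assume "lit_var l1 = lit_var l3"
            then show False
              using false[OF l1(1)] false[OF l3(1)] l1(2) l3(2) y[of l1]
              by (cases l1; cases l3) auto
          next
            assume "lit_var l2 = lit_var l3"
            then show False
              using false[OF l2(1)] false[OF l3(1)] l2(2) l3(2) y[of l2]
              by (cases l2; cases l3) auto
          qed
        next
          case False
          then have gc: "generalized_clause V0 V2 C" using gen C by blast
          then have f: "\<not> lit_true x1 l \<and> \<not> lit_true x2 l \<and> \<not> lit_true x3 l"
            if "l \<in> set (disj_part C)" for l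
            using false0 that by (auto simp: generalized_clause_def)
          have "odd (length (filter (lit_true ?y) (xor_part C))) =
            (odd (length (filter (lit_true x1) (xor_part C))) \<noteq>
            (odd (length (filter (lit_true x2) (xor_part C))) \<noteq>
             odd (length (filter (lit_true x3) (xor_part C)))))"
          proof (rule odd_length_filter_xor)
            fix l assume "l \<in> set (xor_part C)"
            then have "lit_var l \<in> V2" using gc by (auto simp: generalized_clause_def)
            then have "lit_var l \<notin> V0" "lit_var l \<notin> V1" using disj by auto
            then show "lit_true ?y l = (lit_true x1 l \<noteq> (lit_true x2 l \<noteq> lit_true x3 l))"
              by (cases l) (auto simp: g_def)
          qed
          then show False
            using tr f nt by (auto simp: clause_true_def)
        qed
      qed
    qed
  qed
  then have "ternary_aggregator (models \<phi>) g"
    unfolding ternary_aggregator_def by (intro conjI allI ballI) (auto simp: g_def)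
  then show thesis using that cyc by blast
qed


section \<open>Separating a point from a domain\<close>

lemma odd_card_sym_diff3:
  assumes "finite T" "\<And>v. v \<in> T \<Longrightarrow> P v = (P1 v \<noteq> (P2 v \<noteq> P3 v))"
  shows "odd (card {v\<in>T. P v}) =
    (odd (card {v\<in>T. P1 v}) \<noteq> (odd (card {v\<in>T. P2 v}) \<noteq> odd (card {v\<in>T. P3 v})))"
proof -
  obtain ls where ls: "set ls = T" "distinct ls" using finite_distinct_list assms(1) by blast
  have "card {v\<in>T. Q v} = length (filter Q ls)" for Q
    using ls distinct_card[of "filter Q ls"] by simp
  then show ?thesis using odd_length_filter_xor[of ls P P1 P2 P3] assms(2) ls by simp
qed

text \<open>Linear algebra over the field with two elements: \<open>A\<close> is an affine subspace not containing
  zero, linear forms being identified with their supports.\<close>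

lemma affine_separation:
  fixes A :: "('a \<Rightarrow> bool) set"
  assumes "finite S"
    and "\<And>x y z. x \<in> A \<Longrightarrow> y \<in> A \<Longrightarrow> z \<in> A \<Longrightarrow> \<exists>w\<in>A. \<forall>v\<in>S. w v = (x v \<noteq> (y v \<noteq> z v))"
    and "\<And>x. x \<in> A \<Longrightarrow> \<exists>v\<in>S. x v"
  shows "\<exists>T\<subseteq>S. \<forall>x\<in>A. odd (card {v\<in>T. x v})"
  using assms
proof (induction S arbitrary: A rule: finite_induct)
  case empty
  then show ?case by auto
next
  case (insert s S)
  show ?case
  \<comment> \<open>If the restriction to \<open>S\<close> still avoids zero, induction applies
    directly. Otherwise some \<open>e\<close> in \<open>A\<close> is, on \<open>insert s S\<close>,
    the unit vector at \<open>s\<close>.\<close>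
  proof (cases "\<exists>e\<in>A. \<forall>v\<in>S. \<not> e v")
    case False
    have "\<exists>T\<subseteq>S. \<forall>x\<in>A. odd (card {v\<in>T. x v})"
    proof (rule insert.IH)
      fix x y z assume "x \<in> A" "y \<in> A" "z \<in> A"
      from insert.prems(1)[OF this]
      obtain w where "w \<in> A" "\<forall>v\<in>insert s S. w v = (x v \<noteq> (y v \<noteq> z v))"
        by (rule bexE)
      then show "\<exists>w\<in>A. \<forall>v\<in>S. w v = (x v \<noteq> (y v \<noteq> z v))"
        by (intro bexI[of _ w]) simp_all
    next
      fix x assume "x \<in> A"
      then show "\<exists>v\<in>S. x v" using False by simp
    qed
    then show ?thesis by blast
  next
    case True
    then obtain e where e: "e \<in> A" "\<forall>v\<in>S. \<not> e v" by blast
    then have es: "e s" using insert.prems(2)[OF e(1)] by simp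
    \<comment> \<open>This slice is again affine, and it avoids zero already on
      \<open>S\<close>.\<close>
    let ?A0 = "{x\<in>A. \<not> x s}"
    have "\<exists>T\<subseteq>S. \<forall>x\<in>?A0. odd (card {v\<in>T. x v})"
    proof (rule insert.IH)
      fix x y z assume xyz: "x \<in> ?A0" "y \<in> ?A0" "z \<in> ?A0"
      then have "x \<in> A" "y \<in> A" "z \<in> A" by simp_all
      from insert.prems(1)[OF this]
      obtain w where "w \<in> A" "\<forall>v\<in>insert s S. w v = (x v \<noteq> (y v \<noteq> z v))"
        by (rule bexE)
      then show "\<exists>w\<in>?A0. \<forall>v\<in>S. w v = (x v \<noteq> (y v \<noteq> z v))"
        using xyz by (intro bexI[of _ w]) simp_all
    next
      fix x assume "x \<in> ?A0"
      then show "\<exists>v\<in>S. x v" using insert.prems(2)[of x] by auto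
    qed
    then obtain T where T: "T \<subseteq> S" "\<And>x. x \<in> A \<Longrightarrow> \<not> x s \<Longrightarrow> odd (card {v\<in>T. x v})" by blast
    have finT: "finite T" using T(1) insert.hyps(1) finite_subset by blast
    show ?thesis
    proof (cases "?A0 = {}")
      case True
      then have "{v\<in>{s}. x v} = {s}" if "x \<in> A" for x using that by auto
      then have "\<forall>x\<in>A. odd (card {v\<in>{s}. x v})" by simp
      then show ?thesis by (intro exI[of _ "{s}"]) auto
    next
      case False
      then obtain b where b: "b \<in> A" "\<not> b s" by blast
      have "odd (card {v\<in>insert s T. x v})" if xA: "x \<in> A" for x
      proof (cases "x s")
        case False
        then have "{v\<in>insert s T. x v} = {v\<in>T. x v}" by auto
        then show ?thesis using T(2)[OF xA False] by simp
      next
        case True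
        \<comment> \<open>Adding \<open>b\<close> and \<open>e\<close> to \<open>x\<close> leads
          into the slice, and \<open>e\<close> vanishes on \<open>T\<close>. So the form
          \<open>T\<close> is even at \<open>x\<close>, and including \<open>s\<close> in the
          support makes it odd.\<close>
        from insert.prems(1)[OF xA b(1) e(1)]
        obtain w where w: "w \<in> A" "\<forall>v\<in>insert s S. w v = (x v \<noteq> (b v \<noteq> e v))"
          by (rule bexE)
        then have "odd (card {v\<in>T. w v})" using T(2)[of w] True b(2) es by auto
        moreover have "odd (card {v\<in>T. w v}) = (odd (card {v\<in>T. x v}) \<noteq>
            (odd (card {v\<in>T. b v}) \<noteq> odd (card {v\<in>T. e v})))"
          using w(2) T(1) by (intro odd_card_sym_diff3 finT) auto
        moreover have "{v\<in>T. e v} = {}" using e(2) T(1) by auto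
        ultimately have "even (card {v\<in>T. x v})" using T(2)[OF b] by simp
        moreover have "{v\<in>insert s T. x v} = insert s {v\<in>T. x v}" using True by auto
        moreover have "s \<notin> T" using T(1) insert.hyps(2) by blast
        ultimately show ?thesis using finT by simp
      qed
      then show ?thesis using T(1) by (intro exI[of _ "insert s T"]) auto
    qed
  qed
qed

section \<open>Clauses falsified at a given point\<close>

definition false_lit :: "('v \<Rightarrow> bool) \<Rightarrow> 'v \<Rightarrow> 'v literal" where
  "false_lit y v = (if y v then Neg v else Pos v)"

lemma lit_true_false_lit [simp]: "lit_true x (false_lit y v) \<longleftrightarrow> x v \<noteq> y v"
  by (simp add: false_lit_def)

lemma lit_var_false_lit [simp]: "lit_var (false_lit y v) = v"
  by (simp add: false_lit_def)

lemma is_pos_rename_false_lit [simp]: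
  "is_pos (rename_lit W (false_lit y v)) \<longleftrightarrow> y v = (v \<in> W)"
  by (simp add: false_lit_def)

definition admissible_clause ::
  "'v set \<Rightarrow> 'v set \<Rightarrow> 'v set \<Rightarrow> 'v set \<Rightarrow> 'v clause \<Rightarrow> bool" where
  "admissible_clause V0 V1 V2 W C \<longleftrightarrow>
     (clause_vars C \<inter> V1 = {} \<or> clause_vars C \<inter> V2 = {}) \<and>
     (clause_vars C \<subseteq> V0 \<longrightarrow> horn_clause (rename_clause W C)) \<and>
     (\<not> clause_vars C \<subseteq> V0 \<longrightarrow>
        (\<forall>l\<in>clause_lits C. lit_var l \<in> V0 \<longrightarrow> \<not> is_pos (rename_lit W l))) \<and>
     card (clause_vars C \<inter> V1) \<le> 2 \<and>
     (clause_vars C \<inter> V2 \<noteq> {} \<longrightarrow> generalized_clause V0 V2 C) \<and>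
     (clause_vars C \<inter> V2 = {} \<longrightarrow> xor_part C = [])"

text \<open>With partition and renaming fixed, all conditions concern single clauses. Only finitely
  many points lie outside \<open>D\<close>, and one separating clause for each makes up the
  formula.\<close>

lemma constraint_of_admissible_clauses:
  fixes V0 :: "'n::finite set"
  assumes "V0 \<inter> V1 = {}" "V0 \<inter> V2 = {}" "V1 \<inter> V2 = {}" "V0 \<union> V1 \<union> V2 = UNIV" "W \<subseteq> V0"
    and sep: "\<And>y. y \<notin> D \<Longrightarrow>
      \<exists>C. admissible_clause V0 V1 V2 W C \<and> (\<forall>x\<in>D. clause_true x C) \<and> \<not> clause_true y C"
  shows "\<exists>\<phi> :: 'n formula. local_possibility_integrity_constraint UNIV \<phi> \<and> models \<phi> = D"
proof -
  have "\<exists>c. \<forall>y\<in>- D. admissible_clause V0 V1 V2 W (c y) \<and>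
      (\<forall>x\<in>D. clause_true x (c y)) \<and> \<not> clause_true y (c y)"
    by (intro bchoice ballI sep) simp
  then obtain c where c: "\<forall>y\<in>- D. admissible_clause V0 V1 V2 W (c y) \<and>
      (\<forall>x\<in>D. clause_true x (c y)) \<and> \<not> clause_true y (c y)" ..
  obtain \<phi> where \<phi>: "set \<phi> = c ` (- D)"
    using finite_list[of "c ` (- D)"] by auto
  have adm: "admissible_clause V0 V1 V2 W C" if "C \<in> set \<phi>" for C
    using that c \<phi> by auto
  have "partially_horn UNIV V0 (rename W \<phi>)" if "V0 \<noteq> {}"
    using that adm
    by (auto simp: partially_horn_def rename_def formula_over_def admissible_clause_def)
  then have ph: "V0 \<noteq> {} \<longrightarrow> (\<exists>W\<subseteq>V0. partially_horn UNIV V0 (rename W \<phi>))"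
    using assms(5) by blast
  have over: "formula_over UNIV \<phi>" by (simp add: formula_over_def)
  have "local_possibility_integrity_constraint UNIV \<phi>"
    unfolding local_possibility_integrity_constraint_def
    by (rule conjI[OF over], rule exI[of _ V0], rule exI[of _ V1], rule exI[of _ V2],
        intro conjI assms(1-4) ph ballI)
      (use adm in \<open>simp_all add: admissible_clause_def\<close>)
  moreover have "models \<phi> = D"
    using c by (auto simp: models_def \<phi>)
  ultimately show ?thesis by blast
qed

text \<open>The hypothesis on \<open>V0\<close> is conjunction in coordinates renamed by
  \<open>W\<close>: every disagreement is decided by the default value
  \<open>j \<in> W\<close>.\<close>

lemma separating_clause:
  fixes D :: "('n::finite \<Rightarrow> bool) set"
  assumes g: "ternary_aggregator D g"
    and V0: "\<And>j a b c. j \<in> V0 \<Longrightarrow> g j a b c = (if a = b \<and> b = c then a else j \<in> W)"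
    and V1: "\<And>j a b. j \<in> V1 \<Longrightarrow> g j a a b = a \<and> g j a b a = a \<and> g j b a a = a"
    and V2: "\<And>j a b c. j \<in> V2 \<Longrightarrow> g j a b c = (a \<noteq> (b \<noteq> c))"
    and disj: "V0 \<inter> V1 = {}" "V0 \<inter> V2 = {}" "V1 \<inter> V2 = {}" "V0 \<union> V1 \<union> V2 = UNIV"
    and y: "y \<notin> D"
  shows "\<exists>C. admissible_clause V0 V1 V2 W C \<and> (\<forall>x\<in>D. clause_true x C) \<and> \<not> clause_true y C"
proof (rule ccontr)
  assume no: "\<not> ?thesis"
  \<comment> \<open>For these variables \<open>false_lit y\<close> becomes negative after renaming,
    so any number of them may occur both in Horn clauses and in clauses that leave
    \<open>V0\<close>.\<close>
  define U where "U = {v\<in>V0. y v \<noteq> (v \<in> W)}"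
  have UV0: "U \<subseteq> V0" by (auto simp: U_def)
  have closed: "(\<lambda>j. g j (x1 j) (x2 j) (x3 j)) \<in> D" if "x1 \<in> D" "x2 \<in> D" "x3 \<in> D" for x1 x2 x3
    using g that by (auto simp: ternary_aggregator_def)
  have idem: "g j a a a = a" for j a
    using g by (auto simp: ternary_aggregator_def)
  \<comment> \<open>The clause is false exactly at the points that agree with \<open>y\<close> on
    \<open>S\<close>. If \<open>D\<close> had none, the clause would separate \<open>y\<close> from
    \<open>D\<close>.\<close>
  have agree: "\<exists>x\<in>D. \<forall>v\<in>S. x v = y v"
    if adm: "\<And>ls. set ls = S \<Longrightarrow> distinct ls \<Longrightarrow>
      admissible_clause V0 V1 V2 W (Clause (map (false_lit y) ls) [])" for S
  proof (rule ccontr)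
    assume "\<not> ?thesis"
    moreover obtain ls where ls: "set ls = S" "distinct ls" using finite_distinct_list[of S] by auto
    ultimately have "\<forall>x\<in>D. clause_true x (Clause (map (false_lit y) ls) [])"
      "\<not> clause_true y (Clause (map (false_lit y) ls) [])"
      by (auto simp: clause_true_def)
    then show False using no adm[OF ls] by blast
  qed

  have horn: "admissible_clause V0 V1 V2 W (Clause (map (false_lit y) ls) [])"
    if "set ls = S" "distinct ls" "S \<subseteq> V0" "card (S - U) \<le> 1" for S ls
  proof -
    have "length (filter is_pos (map (rename_lit W) (map (false_lit y) ls))) =
        length (filter (\<lambda>v. y v = (v \<in> W)) ls)"
      by (simp add: filter_map o_def)
    also have "\<dots> = card {v\<in>S. y v = (v \<in> W)}"
      using that(1,2) distinct_card[of "filter (\<lambda>v. y v = (v \<in> W)) ls"] by simp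
    also have "{v\<in>S. y v = (v \<in> W)} = S - U" using that(3) by (auto simp: U_def)
    finally have "horn_clause (rename_clause W (Clause (map (false_lit y) ls) []))"
      using that(4) by (simp add: horn_clause_def)
    moreover have "clause_vars (Clause (map (false_lit y) ls) []) = S"
      using that(1) by (simp add: clause_vars_def clause_lits_def image_image)
    moreover have "S \<inter> V1 = {}" "S \<inter> V2 = {}" using that(3) disj by auto
    ultimately show ?thesis using that(3) by (simp add: admissible_clause_def)
  qed
  have "\<exists>x\<in>D. \<forall>v\<in>U \<union> T. x v = y v" if "finite T" "T \<subseteq> V0 - U" for T
    using that
  proof (induction T rule: finite_induct)
    case empty
    show ?case by (rule agree) (use horn UV0 in simp)
  next
    case (insert t T)
    then obtain x where x: "x \<in> D" "\<forall>v\<in>U \<union> T. x v = y v" by auto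
    have "insert t U - U = {t}" using insert.prems by auto
    then have "\<exists>x\<in>D. \<forall>v\<in>insert t U. x v = y v"
      using horn[of _ "insert t U"] insert.prems UV0 by (intro agree) auto
    then obtain z where z: "z \<in> D" "\<forall>v\<in>insert t U. z v = y v" by blast
    \<comment> \<open>On \<open>V0 - U\<close> the value of \<open>y\<close> is the default that
      wins every disagreement, so it is enough that one of \<open>x\<close> and \<open>z\<close>
      agrees with \<open>y\<close>.\<close>
    let ?w = "\<lambda>j. g j (x j) (x j) (z j)"
    show ?case
    proof (rule bexI[of _ ?w], rule ballI)
      show "?w \<in> D" by (rule closed[OF x(1) x(1) z(1)])
    next
      fix v assume v: "v \<in> U \<union> insert t T"
      show "?w v = y v"
      proof (cases "v \<in> U")
        case True
        then show ?thesis using x(2) z(2) idem by simp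
      next
        case False
        then have vT: "v \<in> insert t T" using v by simp
        then have vV0: "v \<in> V0" and "y v = (v \<in> W)" using insert.prems by (auto simp: U_def)
        moreover have "x v = y v \<or> z v = y v" using vT x(2) z(2) by auto
        moreover have "?w v = (if x v = z v then x v else v \<in> W)" using V0[OF vV0] by simp
        ultimately show ?thesis by (auto split: if_splits)
      qed
    qed
  qed
  from this[of "V0 - U"] obtain x0 where "x0 \<in> D" "\<forall>v\<in>U \<union> (V0 - U). x0 v = y v" by auto
  then have x0: "x0 \<in> D" "\<And>v. v \<in> V0 \<Longrightarrow> x0 v = y v" by simp_all

  have bij: "admissible_clause V0 V1 V2 W (Clause (map (false_lit y) ls) [])"
    if "set ls = U \<union> T" "distinct ls" "T \<subseteq> V1" "card T \<le> 2" for T ls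
  proof (cases "T = {}")
    case True
    then show ?thesis using horn[of ls U] that UV0 by simp
  next
    case False
    have "clause_vars (Clause (map (false_lit y) ls) []) = U \<union> T"
      using that(1) by (simp add: clause_vars_def clause_lits_def image_image)
    moreover have "(U \<union> T) \<inter> V1 = T" "(U \<union> T) \<inter> V2 = {}" "\<not> U \<union> T \<subseteq> V0"
      using that(3) disj UV0 False by auto
    moreover have "\<not> is_pos (rename_lit W (false_lit y v))" if "v \<in> U \<union> T" "v \<in> V0" for v
      using that \<open>T \<subseteq> V1\<close> disj(1) by (auto simp: U_def)
    ultimately show ?thesis using that by (auto simp: admissible_clause_def clause_lits_def)
  qed
  have "\<exists>x\<in>D. \<forall>v\<in>U \<union> T. x v = y v" if "T \<subseteq> V1" for T
    using that
  proof (induction "card T" arbitrary: T rule: less_induct)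
    case less
    show ?case
    proof (cases "card T \<le> 2")
      case True
      then show ?thesis using bij less.prems by (intro agree) auto
    next
      case False
      then obtain B where B: "B \<subseteq> T" "card B = 3"
        using obtain_subset_with_card_n[of 3 T] by auto
      obtain a b c where abc: "B = {a, b, c}" "a \<noteq> b" "b \<noteq> c" "a \<noteq> c"
        using B(2) by (auto simp: card_3_iff)
      have ex: "\<exists>x\<in>D. \<forall>v\<in>U \<union> (T - {d}). x v = y v" if "d \<in> B" for d
      proof (rule less.hyps)
        show "card (T - {d}) < card T" using that B(1) by (intro card_Diff1_less) auto
        show "T - {d} \<subseteq> V1" using less.prems by blast
      qed
      have abcB: "a \<in> B" "b \<in> B" "c \<in> B" using abc(1) by simp_all
      from ex[OF abcB(1)] obtain xa where xa: "xa \<in> D" "\<forall>v\<in>U \<union> (T - {a}). xa v = y v" ..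
      from ex[OF abcB(2)] obtain xb where xb: "xb \<in> D" "\<forall>v\<in>U \<union> (T - {b}). xb v = y v" ..
      from ex[OF abcB(3)] obtain xc where xc: "xc \<in> D" "\<forall>v\<in>U \<union> (T - {c}). xc v = y v" ..
      \<comment> \<open>Baker-Pixley: each of the three points may miss \<open>y\<close> on
        \<open>T\<close> at only one of \<open>a\<close>, \<open>b\<close>, \<open>c\<close>, so at
        every variable of \<open>T\<close> two of them agree with \<open>y\<close>, and majority
        follows them.\<close>
      let ?w = "\<lambda>j. g j (xa j) (xb j) (xc j)"
      show ?thesis
      proof (rule bexI[of _ ?w], rule ballI)
        show "?w \<in> D" by (rule closed[OF xa(1) xb(1) xc(1)])
      next
        fix v assume v: "v \<in> U \<union> T"
        show "?w v = y v"
        proof (cases "v \<in> U")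
          case True
          then show ?thesis using xa(2) xb(2) xc(2) idem by simp
        next
          case False
          then have vT: "v \<in> T" using v by simp
          then have vV1: "v \<in> V1" using less.prems by auto
          consider "v \<noteq> a" "v \<noteq> b" | "v \<noteq> a" "v \<noteq> c" | "v \<noteq> b" "v \<noteq> c"
            using abc(2-4) by metis
          then show ?thesis using vT xa(2) xb(2) xc(2) V1[OF vV1] by cases simp_all
        qed
      qed
    qed
  qed
  from this[OF order_refl] obtain x1 where "x1 \<in> D" "\<forall>v\<in>U \<union> V1. x1 v = y v" ..
  then have x1: "x1 \<in> D" "\<And>v. v \<in> U \<Longrightarrow> x1 v = y v" "\<And>v. v \<in> V1 \<Longrightarrow> x1 v = y v"
    by simp_all

  have "\<exists>x\<in>D. \<forall>v\<in>U \<union> V2. x v = y v"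
  proof (rule ccontr)
    assume none: "\<not> ?thesis"
    let ?D = "{x\<in>D. \<forall>v\<in>U. x v = y v}"
    \<comment> \<open>Differences from \<open>y\<close> of the points that agree with
      \<open>y\<close> on \<open>U\<close>; a difference vanishing on \<open>V2\<close> is excluded
      by \<open>none\<close>.\<close>
    let ?A = "(\<lambda>x v. x v \<noteq> y v) ` ?D"
    have "\<exists>T\<subseteq>V2. \<forall>d\<in>?A. odd (card {v\<in>T. d v})"
    proof (rule affine_separation)
      fix d1 d2 d3 assume d: "d1 \<in> ?A" "d2 \<in> ?A" "d3 \<in> ?A"
      from d(1) obtain z1 where z1: "d1 = (\<lambda>v. z1 v \<noteq> y v)" "z1 \<in> ?D" by (rule imageE)
      from d(2) obtain z2 where z2: "d2 = (\<lambda>v. z2 v \<noteq> y v)" "z2 \<in> ?D" by (rule imageE)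
      from d(3) obtain z3 where z3: "d3 = (\<lambda>v. z3 v \<noteq> y v)" "z3 \<in> ?D" by (rule imageE)
      let ?w = "\<lambda>j. g j (z1 j) (z2 j) (z3 j)"
      have "?w \<in> ?D" using closed z1(2) z2(2) z3(2) idem by simp
      then have "(\<lambda>v. ?w v \<noteq> y v) \<in> ?A" by (rule imageI)
      moreover have "\<forall>v\<in>V2. (?w v \<noteq> y v) = (d1 v \<noteq> (d2 v \<noteq> d3 v))"
        using V2 unfolding z1(1) z2(1) z3(1) by auto
      ultimately show "\<exists>w\<in>?A. \<forall>v\<in>V2. w v = (d1 v \<noteq> (d2 v \<noteq> d3 v))"
        by (intro bexI[of _ "\<lambda>v. ?w v \<noteq> y v"])
    next
      fix d assume "d \<in> ?A"
      then obtain x where x: "d = (\<lambda>v. x v \<noteq> y v)" "x \<in> ?D" by (rule imageE)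
      then show "\<exists>v\<in>V2. d v" using none by auto
    qed simp
    then obtain T where T: "T \<subseteq> V2" "\<forall>d\<in>?A. odd (card {v\<in>T. d v})" by (elim exE conjE)
    have odd: "odd (card {v\<in>T. x v \<noteq> y v})" if "x \<in> ?D" for x
      using bspec[OF T(2) imageI[OF that]] .
    \<comment> \<open>\<open>x0\<close> shows that the domain slice is non-empty; hence so is
      \<open>T\<close>, as a generalized clause requires.\<close>
    have "odd (card {v\<in>T. x0 v \<noteq> y v})" using x0 UV0 by (intro odd) auto
    then have "T \<noteq> {}" by auto
    obtain us where us: "set us = U" using finite_list[of U] by auto
    obtain ts where ts: "set ts = T" "distinct ts" using finite_distinct_list[of T] by auto
    \<comment> \<open>A point of \<open>D\<close> that differs from \<open>y\<close> on
      \<open>U\<close> satisfies the disjunctive part; any other has an odd sum. At \<open>y\<close>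
      all literals are false.\<close>
    let ?C = "Clause (map (false_lit y) us) (map (false_lit y) ts)"
    have vars: "clause_vars ?C = U \<union> T"
      using us ts by (simp add: clause_vars_def clause_lits_def image_Un image_image)
    have "(U \<union> T) \<inter> V1 = {}" "(U \<union> T) \<inter> V2 \<noteq> {}" "\<not> U \<union> T \<subseteq> V0"
      using T(1) disj UV0 \<open>T \<noteq> {}\<close> by auto
    moreover have "\<not> is_pos (rename_lit W (false_lit y v))" if "v \<in> U \<union> T" "v \<in> V0" for v
      using that T(1) disj(2) by (auto simp: U_def)
    moreover have "generalized_clause V0 V2 ?C"
      using us ts T(1) UV0 \<open>T \<noteq> {}\<close> by (auto simp: generalized_clause_def)
    ultimately have "admissible_clause V0 V1 V2 W ?C"
      unfolding admissible_clause_def vars using us ts by (auto simp: clause_lits_def)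
    moreover have parity: "length (filter (lit_true x \<circ> false_lit y) ts) =
        card {v\<in>T. x v \<noteq> y v}" for x
      using ts distinct_card[of "filter (\<lambda>v. x v \<noteq> y v) ts"] by (simp add: o_def)
    have "\<forall>x\<in>D. clause_true x ?C"
    proof
      fix x assume "x \<in> D"
      then show "clause_true x ?C"
        using odd[of x] us by (cases "x \<in> ?D") (auto simp: clause_true_def parity)
    qed
    moreover have "\<not> clause_true y ?C"
      by (auto simp: clause_true_def parity)
    ultimately show False using no by blast
  qed
  then obtain x2 where "x2 \<in> D" "\<forall>v\<in>U \<union> V2. x2 v = y v" ..
  then have x2: "x2 \<in> D" "\<And>v. v \<in> U \<Longrightarrow> x2 v = y v" "\<And>v. v \<in> V2 \<Longrightarrow> x2 v = y v"
    by simp_all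

  \<comment> \<open>\<open>x0\<close> corrects \<open>x1\<close> and \<open>x2\<close> on
    \<open>V0\<close>. Majority keeps \<open>x1\<close> on \<open>V1\<close>, and on
    \<open>V2\<close> the two copies of \<open>x0\<close> cancel.\<close>
  define z1 where "z1 = (\<lambda>j. g j (x1 j) (x1 j) (x0 j))"
  define z2 where "z2 = (\<lambda>j. g j (x2 j) (x0 j) (x0 j))"
  have z: "z1 \<in> D" "z2 \<in> D" using closed x0(1) x1(1) x2(1) by (auto simp: z1_def z2_def)
  have z0: "z1 v = y v \<and> z2 v = y v" if "v \<in> V0" for v
  proof (cases "v \<in> U")
    case True
    then show ?thesis using x0(2) x1(2) x2(2) that idem by (simp add: z1_def z2_def)
  next
    case False
    then have "y v = (v \<in> W)" using that by (simp add: U_def)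
    then show ?thesis using x0(2)[OF that] V0[OF that] by (auto simp: z1_def z2_def)
  qed
  \<comment> \<open>On \<open>V1\<close> majority returns the repeated \<open>z1\<close>; on
    \<open>V2\<close> the two copies of \<open>z1\<close> cancel and leave
    \<open>z2\<close>.\<close>
  have "g v (z1 v) (z1 v) (z2 v) = y v" for v
  proof -
    consider "v \<in> V0" | "v \<in> V1" | "v \<in> V2" using disj(4) by blast
    then show ?thesis
    proof cases
      case 1
      then show ?thesis using z0 idem by simp
    next
      case 2
      then show ?thesis using V1 x1(3) by (simp add: z1_def)
    next
      case 3
      then have "z2 v = y v" using V2 x2(3) by (auto simp: z2_def)
      then show ?thesis using V2[OF 3] by auto
    qed
  qed
  then have "y \<in> D" using closed[OF z(1) z(1) z(2)] by simp
  then show False using y by blast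
qed

section \<open>From a cyclic aggregator to a constraint, and the equivalence\<close>

lemma constraint_of_cyclic:
  fixes D :: "('n::finite \<Rightarrow> bool) set"
  assumes g: "ternary_aggregator D g" and cyc: "\<And>j. cyclic (g j)"
  shows "\<exists>\<phi> :: 'n formula. local_possibility_integrity_constraint UNIV \<phi> \<and> models \<phi> = D"
proof -
  \<comment> \<open>By cyclicity and unanimity only the values at one and at two true arguments are
    free. Equal values give disjunction or conjunction; the two unequal cases are majority and
    parity.\<close>
  define V0 where "V0 = {j. g j True False False = g j True True False}"
  define V1 where "V1 = {j. \<not> g j True False False \<and> g j True True False}"
  define V2 where "V2 = {j. g j True False False \<and> \<not> g j True True False}"
  define W where "W = {j\<in>V0. g j True False False}"
  have eqs: "g j True True True" "\<not> g j False False False"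
    "g j False True False = g j True False False" "g j False False True = g j True False False"
    "g j True False True = g j True True False" "g j False True True = g j True True False" for j
    using g cyc[of j] unfolding ternary_aggregator_def cyclic_def by metis+
  have disj: "V0 \<inter> V1 = {}" "V0 \<inter> V2 = {}" "V1 \<inter> V2 = {}" "V0 \<union> V1 \<union> V2 = UNIV" "W \<subseteq> V0"
    by (auto simp: V0_def V1_def V2_def W_def)
  have V0: "g j a b c = (if a = b \<and> b = c then a else j \<in> W)" if "j \<in> V0" for j a b c
    using that eqs[of j] by (cases a; cases b; cases c) (auto simp: V0_def W_def)
  have V1: "g j a a b = a \<and> g j a b a = a \<and> g j b a a = a" if "j \<in> V1" for j a b
    using that eqs[of j] by (cases a; cases b) (auto simp: V1_def)
  have V2: "g j a b c = (a \<noteq> (b \<noteq> c))" if "j \<in> V2" for j a b c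
    using that eqs[of j] by (cases a; cases b; cases c) (auto simp: V2_def)
  show ?thesis
    by (rule constraint_of_admissible_clauses[OF disj])
      (rule separating_clause[OF g V0 V1 V2 disj(1-4)])
qed


theorem theorem4p7:
  fixes D :: "('n::finite \<Rightarrow> bool) set"
  assumes "nondegenerate D"
  shows "local_possibility_domain D \<longleftrightarrow>
    (\<exists>\<phi> :: 'n formula. local_possibility_integrity_constraint UNIV \<phi> \<and> models \<phi> = D)"
proof
  assume "local_possibility_domain D"
  then obtain g where "ternary_aggregator D g" "\<And>j. cyclic (g j)"
    by (rule cyclic_ternary_aggregator) blast
  then show "\<exists>\<phi> :: 'n formula. local_possibility_integrity_constraint UNIV \<phi> \<and> models \<phi> = D"
    by (rule constraint_of_cyclic)
next
  assume "\<exists>\<phi> :: 'n formula. local_possibility_integrity_constraint UNIV \<phi> \<and> models \<phi> = D"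
  then obtain \<phi> :: "'n formula" where "local_possibility_integrity_constraint UNIV \<phi>"
    and D: "models \<phi> = D" by blast
  from this(1) obtain g where "ternary_aggregator (models \<phi>) g" "\<And>j. cyclic (g j)"
    by (rule constraint_models_cyclic) blast
  then show "local_possibility_domain D"
    unfolding D by (rule local_possibility_domain_of_cyclic)
qed

end
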